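(* Let the data $\lambda,\sigma,\gamma,\beta,C_L$ and the notation $\theta,\mu_L,\mu_G,I^+$ be as in the context. Suppose that $\gamma\le\theta$, that the profile under consideration is symmetric (i.e. $C_L$ is an odd function on $[-\beta,\beta]$, so in particular $C_L(0)=0$) with $\gamma>0$, and that $$\mu_G(\max I^+)\le\mu_L(\max I^+),\qquad\text{where } \max I^+=\min\{\theta,\beta+\gamma\}.\qquad(\ast)$$ Then the equation $\mu_L(\varphi)=\mu_G(\varphi)$ admits a solution $\varphi\in[\gamma,\max I^+]$ corresponding to a positive lift, i.e. with $C_L(\varphi-\gamma)>0$. Moreover, if $\max I^+=\theta$, i.e. $\theta\le\beta+\gamma$, then $(\ast)$ is necessarily satisfied.
   Context: Fixed data: real numbers $\lambda>0$ (local speed ratio), $\sigma>0$ (solidity), $\gamma\in(-\frac\pi2,\frac\pi2)$ (twist angle), $\beta>0$, and a function $C_L:[-\beta,\beta]\to\mathbb{R}$ (lift coefficient) which is continuous on $[-\beta,\beta]$ and positive on $(0,\beta]$. Notation: $\theta\in(0,\frac\pi2)$ is defined by $\tan\theta=1/\lambda$. $\mu_L(\varphi):=\frac{\sigma}{4}C_L(\varphi-\gamma)$ for $\varphi\in[-\beta+\gamma,\beta+\gamma]$. $\mu_G(\varphi):=\sin\varphi\,\tan(\theta-\varphi)$ for $\varphi\in(-\frac\pi2+\theta,\frac\pi2+\theta)$. $I:=[-\beta+\gamma,\beta+\gamma]\cap(-\frac\pi2+\theta,\frac\pi2+\theta)$ and $I^+:=I\cap(0,\theta]$.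
   Formalization: Positive lift C_L(φ−γ)>0 is claimed only for γ<θ; when γ=θ the interval [γ, max I⁺] is the single point θ, (∗) holds with equality, and the only solution has C_L(0)=0, so the original claim fails there. *)

theory Defs
  imports "HOL-Analysis.Analysis"
begin

definition mu_L :: "real \<Rightarrow> real \<Rightarrow> (real \<Rightarrow> real) \<Rightarrow> real \<Rightarrow> real" where
  "mu_L \<sigma> \<gamma> C_L \<phi> = \<sigma> / 4 * C_L (\<phi> - \<gamma>)"

definition mu_G :: "real \<Rightarrow> real \<Rightarrow> real" where
  "mu_G \<theta> \<phi> = sin \<phi> * tan (\<theta> - \<phi>)"

text \<open>
  As HOL functions, \<open>mu_L\<close> and \<open>mu_G\<close> are total; \<open>angles\<close> is the intersection of the
  intervals on which the two are mathematically defined.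
\<close>

definition angles :: "real \<Rightarrow> real \<Rightarrow> real \<Rightarrow> real set" where
  "angles \<beta> \<gamma> \<theta> = {- \<beta> + \<gamma> .. \<beta> + \<gamma>} \<inter> {- pi / 2 + \<theta> <..< pi / 2 + \<theta>}"

definition pos_angles :: "real \<Rightarrow> real \<Rightarrow> real \<Rightarrow> real set" where
  "pos_angles \<beta> \<gamma> \<theta> = angles \<beta> \<gamma> \<theta> \<inter> {0 <.. \<theta>}"

text \<open>The operator \<open>Max\<close> is only meaningful for finite sets, hence \<open>Greatest\<close>.\<close>

definition max_pos_angle :: "real \<Rightarrow> real \<Rightarrow> real \<Rightarrow> real" where
  "max_pos_angle \<beta> \<gamma> \<theta> = (GREATEST \<phi>. \<phi> \<in> pos_angles \<beta> \<gamma> \<theta>)"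

text \<open>
  The case \<open>\<gamma> = \<theta>\<close> is degenerate. There the interval \<open>{\<gamma> .. max_pos_angle \<beta> \<gamma> \<theta>}\<close>
  reduces to the point \<open>\<theta>\<close>, which does solve \<open>mu_L \<sigma> \<gamma> C_L \<phi> = mu_G \<theta> \<phi>\<close>, but with lift
  \<open>C_L 0 = 0\<close>. A solution with positive lift can therefore only be claimed for \<open>\<gamma> < \<theta>\<close>.
\<close>

end

theory Submission
  imports Defs
begin

text \<open>
  At \<open>\<phi> = \<gamma>\<close> the lift of a symmetric profile vanishes while \<open>mu_G\<close> is nonnegative, and at the
  maximal angle the inequality is reversed by hypothesis, so the intermediate value theorem
  gives a crossing. If \<open>\<gamma> < \<theta>\<close>, then \<open>mu_G\<close> is strictly positive at \<open>\<gamma>\<close>, so the crossing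
  lies to the right of \<open>\<gamma>\<close>, where the lift is positive. When the maximal angle is \<open>\<theta>\<close>,
  the hypothesis is automatic because \<open>mu_G\<close> vanishes there.
\<close>

text \<open>Only the closed upper ends \<open>\<theta>\<close> and \<open>\<beta> + \<gamma>\<close>
  bind: \<open>\<theta>\<close> lies strictly inside the open interval, and the smaller of the two
  is at least \<open>\<gamma> > 0\<close>. Hence the maximum is attained.\<close>

lemma max_pos_angle_props:
  assumes "\<beta> > 0" "0 < \<gamma>" "\<gamma> \<le> \<theta>" "\<theta> < pi / 2"
  shows "max_pos_angle \<beta> \<gamma> \<theta> = min \<theta> (\<beta> + \<gamma>)"
    and "max_pos_angle \<beta> \<gamma> \<theta> \<in> pos_angles \<beta> \<gamma> \<theta>"
proof -
  have mem: "min \<theta> (\<beta> + \<gamma>) \<in> pos_angles \<beta> \<gamma> \<theta>"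
    using assms pi_gt_zero by (auto simp: pos_angles_def angles_def min_def)
  show eq: "max_pos_angle \<beta> \<gamma> \<theta> = min \<theta> (\<beta> + \<gamma>)"
    unfolding max_pos_angle_def
    by (rule Greatest_equality, rule mem) (auto simp: pos_angles_def angles_def)
  show "max_pos_angle \<beta> \<gamma> \<theta> \<in> pos_angles \<beta> \<gamma> \<theta>"
    using mem eq by simp
qed

lemma mu_G_self [simp]: "mu_G \<theta> \<theta> = 0"
  by (simp add: mu_G_def)

lemma mu_G_pos:
  assumes "0 < \<phi>" "\<phi> < \<theta>" "\<theta> < pi / 2"
  shows "mu_G \<theta> \<phi> > 0"
  unfolding mu_G_def using assms by (intro mult_pos_pos sin_gt_zero tan_gt_zero) auto

text \<open>For these angles \<open>\<theta> - \<phi>\<close> stays in [0, pi/2), away from the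
  poles of \<open>tan\<close>.\<close>

lemma continuous_on_mu_G:
  assumes "0 \<le> a" "b \<le> \<theta>" "\<theta> < pi / 2"
  shows "continuous_on {a..b} (mu_G \<theta>)"
proof -
  have "cos (\<theta> - \<phi>) \<noteq> 0" if "\<phi> \<in> {a..b}" for \<phi>
    using cos_gt_zero_pi[of "\<theta> - \<phi>"] that assms by auto
  then show ?thesis
    unfolding mu_G_def by (intro continuous_intros) auto
qed

lemma continuous_on_mu_L:
  assumes "continuous_on {c - \<gamma>..d - \<gamma>} C_L"
  shows "continuous_on {c..d} (mu_L \<sigma> \<gamma> C_L)"
  unfolding mu_L_def
  by (intro continuous_intros continuous_on_compose2[OF assms]) auto

theorem corollary3p2:
  fixes lam \<sigma> \<gamma> \<beta> \<theta> :: real and C_L :: "real \<Rightarrow> real"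
  assumes "lam > 0" and "\<sigma> > 0" and "- pi / 2 < \<gamma>" and "\<gamma> < pi / 2" and "\<beta> > 0"
    and "continuous_on {- \<beta> .. \<beta>} C_L"
    and "\<forall>\<alpha>\<in>{0 <.. \<beta>}. C_L \<alpha> > 0"
    and "0 < \<theta>" and "\<theta> < pi / 2" and "tan \<theta> = 1 / lam"
    and "\<gamma> \<le> \<theta>"
    and "\<forall>\<alpha>\<in>{- \<beta> .. \<beta>}. C_L (- \<alpha>) = - C_L \<alpha>"
    and "\<gamma> > 0"
  shows "max_pos_angle \<beta> \<gamma> \<theta> \<in> pos_angles \<beta> \<gamma> \<theta>
    \<and> max_pos_angle \<beta> \<gamma> \<theta> = min \<theta> (\<beta> + \<gamma>)
    \<and> (mu_G \<theta> (max_pos_angle \<beta> \<gamma> \<theta>) \<le> mu_L \<sigma> \<gamma> C_L (max_pos_angle \<beta> \<gamma> \<theta>)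
        \<longrightarrow> (\<exists>\<phi>\<in>{\<gamma> .. max_pos_angle \<beta> \<gamma> \<theta>}.
              mu_L \<sigma> \<gamma> C_L \<phi> = mu_G \<theta> \<phi> \<and> (\<gamma> < \<theta> \<longrightarrow> C_L (\<phi> - \<gamma>) > 0)))
    \<and> (max_pos_angle \<beta> \<gamma> \<theta> = \<theta> \<longleftrightarrow> \<theta> \<le> \<beta> + \<gamma>)
    \<and> (max_pos_angle \<beta> \<gamma> \<theta> = \<theta>
        \<longrightarrow> mu_G \<theta> (max_pos_angle \<beta> \<gamma> \<theta>) \<le> mu_L \<sigma> \<gamma> C_L (max_pos_angle \<beta> \<gamma> \<theta>))"
proof -
  let ?m = "max_pos_angle \<beta> \<gamma> \<theta>"
  note m = max_pos_angle_props[OF \<open>\<beta> > 0\<close> \<open>\<gamma> > 0\<close> \<open>\<gamma> \<le> \<theta>\<close> \<open>\<theta> < pi / 2\<close>]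
  have bounds: "\<gamma> \<le> ?m" "?m \<le> \<theta>" "?m \<le> \<beta> + \<gamma>"
    using m(1) assms by auto
  have "C_L (- 0) = - C_L 0"
    using \<open>\<beta> > 0\<close> by (intro bspec[OF assms(12)]) auto
  then have C0: "C_L 0 = 0"
    by simp
  have sol: "\<exists>\<phi>\<in>{\<gamma>..?m}. mu_L \<sigma> \<gamma> C_L \<phi> = mu_G \<theta> \<phi> \<and> (\<gamma> < \<theta> \<longrightarrow> C_L (\<phi> - \<gamma>) > 0)"
    if le: "mu_G \<theta> ?m \<le> mu_L \<sigma> \<gamma> C_L ?m"
  proof -
    let ?f = "\<lambda>\<phi>. mu_G \<theta> \<phi> - mu_L \<sigma> \<gamma> C_L \<phi>"
    have L0: "mu_L \<sigma> \<gamma> C_L \<gamma> = 0"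
      using C0 by (simp add: mu_L_def)
    have G: "\<gamma> < \<theta> \<longrightarrow> mu_G \<theta> \<gamma> > 0"
      using mu_G_pos assms by blast
    \<comment> \<open>In the degenerate case \<open>\<gamma> = \<theta>\<close> both terms vanish,
      so only a weak inequality holds here.\<close>
    then have "0 \<le> ?f \<gamma>"
      using L0 \<open>\<gamma> \<le> \<theta>\<close> by (cases "\<gamma> = \<theta>") auto
    \<comment> \<open>Shifting by \<open>\<gamma>\<close> turns the interval into
      [0, \<open>?m - \<gamma>\<close>], which is contained in the domain [-\<open>\<beta>\<close>,
      \<open>\<beta>\<close>] of \<open>C_L\<close>.\<close>
    moreover have "continuous_on {\<gamma>..?m} ?f"
      using bounds assms
      by (intro continuous_on_diff continuous_on_mu_G continuous_on_mu_L
          continuous_on_subset[OF assms(6)]) auto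
    ultimately obtain \<phi> where \<phi>: "\<gamma> \<le> \<phi>" "\<phi> \<le> ?m" "?f \<phi> = 0"
      using IVT2'[of ?f ?m 0 \<gamma>] le bounds by auto
    have "C_L (\<phi> - \<gamma>) > 0" if "\<gamma> < \<theta>"
    proof -
      \<comment> \<open>At \<open>\<gamma>\<close> the difference \<open>?f\<close> equals
        \<open>mu_G \<theta> \<gamma> > 0\<close>, so its zero lies further right and
        \<open>\<phi> - \<gamma>\<close> falls into (0, \<open>\<beta>\<close>].\<close>
      have "\<phi> \<noteq> \<gamma>"
        using \<phi>(3) G L0 that by auto
      then show ?thesis
        using \<phi> bounds assms(7) by auto
    qed
    with \<phi> show ?thesis
      by (intro bexI[of _ \<phi>]) auto
  qed
  have auto_le: "mu_G \<theta> ?m \<le> mu_L \<sigma> \<gamma> C_L ?m" if eq: "?m = \<theta>"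
  proof -
    \<comment> \<open>Since \<open>mu_G \<theta> \<theta> = 0\<close>, the claim reduces to
      nonnegative lift at \<open>\<theta>\<close>; the bound
      \<open>?m \<le> \<beta> + \<gamma>\<close> keeps \<open>\<theta> - \<gamma>\<close> within
      \<open>\<beta>\<close>.\<close>
    have "C_L (\<theta> - \<gamma>) \<ge> 0"
    proof (cases "\<gamma> = \<theta>")
      case False
      then have "\<theta> - \<gamma> \<in> {0<..\<beta>}"
        using bounds eq by auto
      then show ?thesis
        using assms(7) less_imp_le by blast
    qed (simp add: C0)
    then show ?thesis
      using eq \<open>\<sigma> > 0\<close> by (simp add: mu_L_def)
  qed
  have "?m = \<theta> \<longleftrightarrow> \<theta> \<le> \<beta> + \<gamma>"
    using m(1) by auto
  with m sol auto_le show ?thesis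
    by blast
qed

end
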